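(* Let $k\geq 1$ and $n\geq 4^k$ be integers, and let $G$ be a graph of order $n$ with complement $\overline{G}$. Then either \[ \mu_{n-k+1}(G)\leq -1\quad\text{and}\quad \mu_{n-k+1}(\overline{G})\leq 0, \] or \[ \mu_{n-k+1}(\overline{G})\leq -1\quad\text{and}\quad \mu_{n-k+1}(G)\leq 0. \]
   Context: Graphs are finite and simple. For a graph $G$ of order $n$, $\mu_1(G)\geq\mu_2(G)\geq\cdots\geq\mu_n(G)$ denote the eigenvalues of its adjacency matrix, and $\overline{G}$ denotes the complement of $G$. *)

theory Defs
  imports "HOL-Library.Ramsey" "Jordan_Normal_Form.Char_Poly"
begin

text \<open>
  Graphs are given by a vertex set \<open>V\<close> and a set \<open>E\<close> of two-element subsets of \<open>V\<close>, which is
  the convention of \<open>HOL-Library.Ramsey\<close>; \<open>nsets V 2\<close> is the edge set of the complete graph on \<open>V\<close>.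
\<close>

definition finite_simple_graph :: "'a set \<Rightarrow> 'a set set \<Rightarrow> bool" where
  "finite_simple_graph V E \<longleftrightarrow> finite V \<and> E \<subseteq> nsets V 2"

definition complement_edges :: "'a set \<Rightarrow> 'a set set \<Rightarrow> 'a set set" where
  "complement_edges V E = nsets V 2 - E"

definition adjacency_matrix :: "'a list \<Rightarrow> 'a set set \<Rightarrow> real mat" where
  "adjacency_matrix vs E =
     mat (length vs) (length vs) (\<lambda>(i, j). if {vs ! i, vs ! j} \<in> E then 1 else 0)"

text \<open>
  The choice of the enumeration is immaterial: two enumerations of \<open>V\<close> give adjacency matrices
  that are conjugate by a permutation matrix, hence have the same characteristic polynomial.
\<close>

definition vertex_enumeration :: "'a set \<Rightarrow> 'a list" where
  "vertex_enumeration V = (SOME vs. distinct vs \<and> set vs = V)"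

text \<open>
  All eigenvalues of the adjacency matrix, repeated according to multiplicity, in non-increasing
  order. Since the matrix is real symmetric, its characteristic polynomial splits over the reals,
  so this list has \<open>card V\<close> entries for a finite simple graph.
\<close>

definition graph_eigenvalues :: "'a set \<Rightarrow> 'a set set \<Rightarrow> real list" where
  "graph_eigenvalues V E =
     rev (sorted_list_of_multiset
       (proots (char_poly (adjacency_matrix (vertex_enumeration V) E))))"

text \<open>The eigenvalues are numbered from 1 to \<open>card V\<close>, whereas list positions start at 0.\<close>

definition graph_mu :: "'a set \<Rightarrow> 'a set set \<Rightarrow> nat \<Rightarrow> real" where
  "graph_mu V E i = graph_eigenvalues V E ! (i - 1)"

end

theory Submission
  imports Defs
begin

text \<open>
  Since \<open>4 ^ k = 2 ^ (k + k)\<close>, Ramsey's theorem yields \<open>k + 1\<close> vertices that form a clique in the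
  graph or in its complement. If \<open>A\<close> is the adjacency matrix of a graph and \<open>x\<close> is supported on a
  clique and has entry sum 0, then \<open>x \<bullet> A x = - (x \<bullet> x)\<close>; if \<open>x\<close> is supported on an independent set,
  then \<open>x \<bullet> A x = 0\<close>. These vectors form spaces of dimension at least \<open>k\<close>, so by the min-max
  principle the \<open>k\<close>-th smallest eigenvalue is at most \<open>-1\<close> and at most \<open>0\<close>, respectively.
\<close>

section \<open>Ramsey's bound\<close>

text \<open>Pick a vertex \<open>v\<close> and split the others into neighbours \<open>N\<close> and
  non-neighbours \<open>M\<close>; one part keeps half of the bound. In \<open>N\<close> the
  parameter \<open>a\<close> drops by one and \<open>v\<close> extends a clique; in \<open>M\<close>
  the parameter \<open>b\<close> drops by one and \<open>v\<close> extends an independent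
  set.\<close>

lemma clique_or_indep_of_two_power_le_card:
  fixes V :: "'a set" and E :: "'a set set"
  assumes "finite V" and "2 ^ (a + b) \<le> card V"
  shows "\<exists>R\<subseteq>V. card R = Suc a \<and> clique R E \<or> card R = Suc b \<and> indep R E"
  using assms
proof (induction "a + b" arbitrary: a b V)
  case 0
  then have "V \<noteq> {}" by (cases "V = {}") auto
  then obtain v where "v \<in> V" by blast
  then show ?case
    using 0 by (intro exI[of _ "{v}"]) (simp add: clique_def)
next
  case (Suc m)
  from Suc.prems have "card V \<noteq> 0"
    by (metis le_zero_eq power_not_zero zero_neq_numeral)
  then obtain v where v: "v \<in> V" by (metis card.empty ex_in_conv)
  show ?case
  proof (cases "a = 0 \<or> b = 0")
    \<comment> \<open>A single vertex is vacuously both a clique and an independent set.\<close>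
    case True
    then show ?thesis
      using v by (intro exI[of _ "{v}"]) (auto simp: clique_def indep_def)
  next
    case False
    then obtain a' b' where ab: "a = Suc a'" "b = Suc b'"
      by (meson not0_implies_Suc)
    define N where "N = {w \<in> V. w \<noteq> v \<and> {v, w} \<in> E}"
    define M where "M = {w \<in> V. w \<noteq> v \<and> {v, w} \<notin> E}"
    have fin: "finite N" "finite M"
      using Suc.prems by (auto simp: N_def M_def)
    have "V = insert v (N \<union> M)" and "v \<notin> N \<union> M" using v by (auto simp: N_def M_def)
    then have "card V = Suc (card (N \<union> M))"
      using fin by simp
    also have "card (N \<union> M) = card N + card M"
      using fin by (intro card_Un_disjoint) (auto simp: N_def M_def)
    finally have "card V = Suc (card N + card M)" .
    moreover have "(2::nat) ^ (a + b) = 2 ^ m + 2 ^ m"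
      using Suc.hyps(2) by (metis mult_2 power_Suc)
    \<comment> \<open>If both parts had at most \<open>2 ^ m - 1\<close> vertices, then
      \<open>card V\<close>, which also counts \<open>v\<close>, would be at most
      \<open>2 ^ (m + 1) - 1\<close>.\<close>
    ultimately consider "2 ^ m \<le> card N" | "2 ^ m \<le> card M"
      using Suc.prems by linarith
    then show ?thesis
    proof cases
      case 1
      moreover have m: "m = a' + b" using Suc.hyps ab by simp
      ultimately obtain R where R: "R \<subseteq> N" "card R = Suc a' \<and> clique R E \<or> card R = Suc b \<and> indep R E"
        using Suc.hyps(1)[of a' b N] fin by blast
      have "finite R" "v \<notin> R" "R \<subseteq> V" using R fin by (auto simp: N_def intro: finite_subset)
      moreover have "clique (insert v R) E" if "clique R E"
        using that R(1) by (auto simp: clique_def N_def insert_commute)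
      ultimately show ?thesis using R(2) v ab(1)
        by (metis card_insert_disjoint insert_subset)
    next
      case 2
      moreover have m: "m = a + b'" using Suc.hyps ab by simp
      ultimately obtain R where R: "R \<subseteq> M" "card R = Suc a \<and> clique R E \<or> card R = Suc b' \<and> indep R E"
        using Suc.hyps(1)[of a b' M] fin by blast
      have "finite R" "v \<notin> R" "R \<subseteq> V" using R fin by (auto simp: M_def intro: finite_subset)
      moreover have "indep (insert v R) E" if "indep R E"
        using that R(1) by (auto simp: indep_def M_def insert_commute)
      ultimately show ?thesis using R(2) v ab(2)
        by (metis card_insert_disjoint insert_subset)
    qed
  qed
qed

section \<open>The spectral theorem for real symmetric matrices\<close>

text \<open>Over the complex numbers the characteristic polynomial has a root \<open>a\<close> with
  an eigenvector \<open>v\<close>. As the matrix is symmetric with real entries, moving it across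
  the Hermitian product gives \<open>a * (v \<bullet>c v) = cnj a * (v \<bullet>c v)\<close>. Hence
  \<open>a\<close> is real and yields a root over the reals.\<close>

lemma symmetric_mat_eigenvalue_exists:
  fixes A :: "real mat"
  assumes A: "A \<in> carrier_mat n n" and sym: "A\<^sup>T = A" and n: "n > 0"
  shows "\<exists>e. eigenvalue A e"
proof -
  let ?C = "map_mat complex_of_real A"
  have C: "?C \<in> carrier_mat n n" using A by simp
  obtain as where as: "char_poly ?C = (\<Prod>a\<leftarrow>as. [:- a, 1:])" "length as = n"
    using char_poly_factorized[OF C] by blast
  then obtain a as' where "as = a # as'" using n by (cases as) auto
  then have root: "poly (char_poly ?C) a = 0" using as by simp
  then obtain v where v: "v \<in> carrier_vec n" "v \<noteq> 0\<^sub>v n" "?C *\<^sub>v v = a \<cdot>\<^sub>v v"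
    using eigenvalue_root_char_poly[OF C] A unfolding eigenvalue_def eigenvector_def by auto
  have "a * (v \<bullet>c v) = (?C *\<^sub>v v) \<bullet>c v"
    using v by simp
  also have "\<dots> = v \<bullet> (?C *\<^sub>v conjugate v)"
  proof -
    have "?C\<^sup>T = ?C" using sym by (metis map_mat_transpose)
    then show ?thesis
      using transpose_vec_mult_scalar[OF C v(1), of "conjugate v"] v(1) C
      by (metis carrier_vec_conjugate comm_scalar_prod mult_mat_vec_carrier)
  qed
  also have "?C *\<^sub>v conjugate v = conjugate (?C *\<^sub>v v)"
    using v(1) A by (intro eq_vecI) (auto simp: scalar_prod_def)
  also have "\<dots> = cnj a \<cdot>\<^sub>v conjugate v"
    by (simp add: v(3) conjugate_smult_vec)
  also have "v \<bullet> (cnj a \<cdot>\<^sub>v conjugate v) = cnj a * (v \<bullet>c v)"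
    using v(1) by simp
  finally have "a = cnj a"
    using v conjugate_square_eq_0_vec[OF v(1)] by simp
  then have "a = complex_of_real (Re a)"
    by (metis Reals_cnj_iff of_real_Re)
  then have "complex_of_real (poly (char_poly A) (Re a)) = 0"
    using root by (metis of_real_hom.char_poly_hom[OF A] of_real_hom.poly_map_poly)
  then show ?thesis
    using eigenvalue_root_char_poly[OF A] by auto
qed

text \<open>
  The Householder reflection in the hyperplane orthogonal to \<open>w\<close>; for \<open>w = 0\<close> it is the identity,
  because \<open>2 / 0 = 0\<close>.
\<close>

definition reflection_mat :: "nat \<Rightarrow> real vec \<Rightarrow> real mat" where
  "reflection_mat n w = mat n n (\<lambda>(i, j). (if i = j then 1 else 0) - 2 / (w \<bullet> w) * (w $ i * w $ j))"

lemma reflection_mat_carrier [simp]: "reflection_mat n w \<in> carrier_mat n n"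
  by (simp add: reflection_mat_def)

lemma reflection_mat_transpose [simp]: "(reflection_mat n w)\<^sup>T = reflection_mat n w"
  by (intro eq_matI) (auto simp: reflection_mat_def)

lemma reflection_mat_mult_vec:
  assumes w: "w \<in> carrier_vec n" and x: "x \<in> carrier_vec n"
  shows "reflection_mat n w *\<^sub>v x = x - (2 * (w \<bullet> x) / (w \<bullet> w)) \<cdot>\<^sub>v w"
proof (intro eq_vecI)
  fix i assume "i < dim_vec (x - (2 * (w \<bullet> x) / (w \<bullet> w)) \<cdot>\<^sub>v w)"
  then have i: "i < n" using w by simp
  let ?c = "2 / (w \<bullet> w)"
  have "(reflection_mat n w *\<^sub>v x) $ i
      = (\<Sum>j = 0..<n. ((if i = j then 1 else 0) - ?c * (w $ i * w $ j)) * x $ j)"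
    using i x by (simp add: reflection_mat_def scalar_prod_def)
  also have "\<dots> = (\<Sum>j = 0..<n. (if i = j then x $ j else 0) - ?c * w $ i * (w $ j * x $ j))"
    by (intro sum.cong) (auto simp: algebra_simps)
  also have "\<dots> = x $ i - ?c * w $ i * (w \<bullet> x)"
    using i x by (simp add: sum_subtractf sum_distrib_left scalar_prod_def)
  finally show "(reflection_mat n w *\<^sub>v x) $ i = (x - (2 * (w \<bullet> x) / (w \<bullet> w)) \<cdot>\<^sub>v w) $ i"
    using i w x by simp
qed (use w in \<open>simp add: reflection_mat_def\<close>)

lemma reflection_mat_involution:
  assumes w: "w \<in> carrier_vec n"
  shows "reflection_mat n w * reflection_mat n w = 1\<^sub>m n"
proof (rule eq_matI)
  fix i j assume "i < dim_row (1\<^sub>m n :: real mat)" "j < dim_col (1\<^sub>m n :: real mat)"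
  then have ij: "i < n" "j < n" by auto
  let ?H = "reflection_mat n w"
  obtain c where c: "c = 2 / (w \<bullet> w)" by blast
  have ww: "w \<bullet> w = (\<Sum>k = 0..<n. w $ k * w $ k)"
    using w by (simp add: scalar_prod_def)
  have "(?H * ?H) $$ (i, j) = (\<Sum>k = 0..<n. ((if i = k then 1 else 0) - c * (w $ i * w $ k)) *
      ((if k = j then 1 else 0) - c * (w $ k * w $ j)))"
    using ij by (simp add: reflection_mat_def scalar_prod_def c)
  also have "\<dots> = (\<Sum>k = 0..<n. (if i = k then (if i = j then 1 else 0) else 0)
      - (if i = k then c * (w $ i * w $ j) else 0) - (if k = j then c * (w $ i * w $ j) else 0)
      + c * c * w $ i * w $ j * (w $ k * w $ k))"
    by (intro sum.cong) (auto simp: algebra_simps)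
  also have "\<dots> = (if i = j then 1 else 0) - 2 * c * (w $ i * w $ j)
      + c * c * w $ i * w $ j * (w \<bullet> w)"
    using ij by (simp add: sum.distrib sum_subtractf sum_distrib_left[symmetric] ww)
  \<comment> \<open>If \<open>w \<bullet> w\<close> is nonzero, then
    \<open>c * (w \<bullet> w) = 2\<close> and the last two terms cancel; otherwise
    \<open>c = 2 / 0 = 0\<close>.\<close>
  also have "\<dots> = (if i = j then 1 else 0)"
    by (cases "w \<bullet> w = 0") (auto simp: c field_simps)
  finally show "(?H * ?H) $$ (i, j) = 1\<^sub>m n $$ (i, j)"
    using ij by simp
qed (auto simp: reflection_mat_def)

text \<open>Reflecting along the difference of two vectors of equal length exchanges them: with
  \<open>w = v - e\<close>, equal lengths give \<open>w \<bullet> w = - 2 * (w \<bullet> e)\<close>,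
  so the reflection formula turns \<open>e\<close> into \<open>e + w\<close>.\<close>

lemma reflection_mat_unit_vec:
  assumes v: "v \<in> carrier_vec n" "v \<bullet> v = 1" and n: "0 < n"
  shows "reflection_mat n (v - unit_vec n 0) *\<^sub>v unit_vec n 0 = v"
proof -
  let ?e = "unit_vec n 0 :: real vec"
  let ?w = "v - ?e"
  have e: "?e \<in> carrier_vec n" and w: "?w \<in> carrier_vec n" using v by auto
  have we: "?w \<bullet> ?e = v $ 0 - 1"
    using v n by simp
  have "?w \<bullet> ?w = v \<bullet> v - v \<bullet> ?e - (?e \<bullet> v - ?e \<bullet> ?e)"
    using v e w by (simp add: minus_scalar_prod_distrib[of _ n] scalar_prod_minus_distrib[of _ n])
  then have ww: "?w \<bullet> ?w = - 2 * (?w \<bullet> ?e)"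
    using v n we by simp
  show ?thesis
  proof (cases "?w \<bullet> ?w = 0")
    \<comment> \<open>Here \<open>v\<close> is itself the unit vector, and the degenerate reflection
      is the identity.\<close>
    case True
    then have "?w = 0\<^sub>v n"
      using conjugate_square_eq_0_vec[OF w] by simp
    have "v $ i = ?e $ i" if "i < n" for i
    proof -
      have "?w $ i = 0" using \<open>?w = 0\<^sub>v n\<close> that by simp
      then show ?thesis using that v by simp
    qed
    then have "v = ?e"
      using v by (intro eq_vecI) auto
    then show ?thesis
      using e by (simp add: reflection_mat_mult_vec[of _ n]) (intro eq_vecI, auto)
  next
    case False
    then have "2 * (?w \<bullet> ?e) / (?w \<bullet> ?w) = - 1" using ww by simp
    then show ?thesis
      unfolding reflection_mat_mult_vec[OF w e] using v by (intro eq_vecI) auto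
  qed
qed

text \<open>Take a unit eigenvector \<open>v\<close> and the reflection \<open>H\<close> that
  exchanges \<open>v\<close> with the first unit vector. Conjugating by \<open>H\<close> makes the
  first unit vector an eigenvector, which fixes the first column; symmetry fixes the first row, and
  \<open>B\<close> is what remains.\<close>

lemma symmetric_mat_deflation:
  fixes A :: "real mat"
  assumes A: "A \<in> carrier_mat (Suc n) (Suc n)" and sym: "A\<^sup>T = A"
  shows "\<exists>H e B. H \<in> carrier_mat (Suc n) (Suc n) \<and> H\<^sup>T * H = 1\<^sub>m (Suc n) \<and>
    B \<in> carrier_mat n n \<and> B\<^sup>T = B \<and>
    H\<^sup>T * A * H = four_block_mat (e \<cdot>\<^sub>m 1\<^sub>m 1) (0\<^sub>m 1 n) (0\<^sub>m n 1) B"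
proof -
  let ?n = "Suc n"
  obtain e u where u: "u \<in> carrier_vec ?n" "u \<noteq> 0\<^sub>v ?n" "A *\<^sub>v u = e \<cdot>\<^sub>v u"
    using symmetric_mat_eigenvalue_exists[OF A sym] A unfolding eigenvalue_def eigenvector_def by auto
  have "u \<bullet> u > 0" using u conjugate_square_greater_0_vec[OF u(1)] by simp
  define v where "v = (1 / sqrt (u \<bullet> u)) \<cdot>\<^sub>v u"
  have v: "v \<in> carrier_vec ?n" "v \<bullet> v = 1" "A *\<^sub>v v = e \<cdot>\<^sub>v v"
    using u \<open>u \<bullet> u > 0\<close> A
    by (auto simp: v_def mult_mat_vec smult_smult_assoc mult.commute real_sqrt_mult_self)
  define H where "H = reflection_mat ?n (v - unit_vec ?n 0)"
  have H: "H \<in> carrier_mat ?n ?n" "H\<^sup>T = H" "H * H = 1\<^sub>m ?n"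
    using v by (auto simp: H_def reflection_mat_involution)
  have He: "H *\<^sub>v unit_vec ?n 0 = v"
    unfolding H_def using v by (intro reflection_mat_unit_vec) auto
  then have Hv: "H *\<^sub>v v = unit_vec ?n 0"
    using H by (metis assoc_mult_mat_vec one_mult_mat_vec unit_vec_carrier)
  define C where "C = H * A * H"
  have C: "C \<in> carrier_mat ?n ?n" using H A by (simp add: C_def)
  have Csym: "C\<^sup>T = C"
    using H A sym by (simp add: C_def transpose_mult[of _ ?n ?n _ ?n] assoc_mult_mat[of _ ?n ?n _ ?n _ ?n])
  \<comment> \<open>\<open>H\<close> sends the first unit vector to \<open>v\<close>,
    \<open>A\<close> scales \<open>v\<close> by \<open>e\<close>, and \<open>H\<close> sends
    \<open>v\<close> back.\<close>
  have "C *\<^sub>v unit_vec ?n 0 = e \<cdot>\<^sub>v unit_vec ?n 0"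
    using H A v by (simp add: C_def assoc_mult_mat_vec[of _ ?n ?n _ ?n] He Hv mult_mat_vec[of _ ?n ?n])
  then have col: "C $$ (i, 0) = (if i = 0 then e else 0)" if "i < ?n" for i
    using that C by (metis (no_types, lifting) carrier_matD(1) carrier_matD(2) index_mult_mat_vec index_row(1) index_smult_vec(1) index_unit_vec(1) index_unit_vec(3) mult.right_neutral mult_zero_right row_carrier scalar_prod_right_unit zero_less_Suc)
  have row: "C $$ (0, i) = (if i = 0 then e else 0)" if "i < ?n" for i
    using col[OF that] Csym C that by (metis carrier_matD index_transpose_mat(1) zero_less_Suc)
  define B where "B = mat n n (\<lambda>(i, j). C $$ (Suc i, Suc j))"
  have "B\<^sup>T = B"
    unfolding B_def using C by (intro eq_matI) (auto, metis Csym C carrier_matD index_transpose_mat(1) Suc_less_eq)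
  moreover have "C = four_block_mat (e \<cdot>\<^sub>m 1\<^sub>m 1) (0\<^sub>m 1 n) (0\<^sub>m n 1) B"
    using C row col by (intro eq_matI) (auto simp: B_def)
  ultimately show ?thesis
    using H unfolding C_def by (intro exI[of _ H] exI[of _ e] exI[of _ B]) (auto simp: B_def)
qed

text \<open>Induction on the dimension: deflate with \<open>H\<close>, diagonalize the smaller block
  \<open>B\<close> by \<open>Q\<close>, and combine the two as \<open>H\<close> times the block
  diagonal matrix with blocks 1 and \<open>Q\<close>.\<close>

theorem symmetric_mat_diagonalization:
  fixes A :: "real mat"
  assumes "A \<in> carrier_mat n n" and "A\<^sup>T = A"
  shows "\<exists>P D. P \<in> carrier_mat n n \<and> D \<in> carrier_mat n n \<and> P\<^sup>T * P = 1\<^sub>m n \<and>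
    diagonal_mat D \<and> P\<^sup>T * A * P = D"
  using assms
proof (induction n arbitrary: A)
  case 0
  then show ?case
    by (intro exI[of _ "1\<^sub>m 0"] exI[of _ A]) (auto simp: diagonal_mat_def)
next
  case (Suc n)
  let ?n = "Suc n"
  obtain H e B where H: "H \<in> carrier_mat ?n ?n" "H\<^sup>T * H = 1\<^sub>m ?n"
    and B: "B \<in> carrier_mat n n" "B\<^sup>T = B"
    and HAH: "H\<^sup>T * A * H = four_block_mat (e \<cdot>\<^sub>m 1\<^sub>m 1) (0\<^sub>m 1 n) (0\<^sub>m n 1) B"
    using symmetric_mat_deflation[OF Suc.prems] by blast
  obtain Q D where Q: "Q \<in> carrier_mat n n" "D \<in> carrier_mat n n" "Q\<^sup>T * Q = 1\<^sub>m n"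
    "diagonal_mat D" "Q\<^sup>T * B * Q = D"
    using Suc.IH[OF B] by blast
  \<comment> \<open>Block diagonal matrices of this shape multiply and transpose block by block, so
    all computations reduce to those for \<open>Q\<close> and \<open>B\<close>.\<close>
  let ?F = "\<lambda>a X. four_block_mat (a \<cdot>\<^sub>m 1\<^sub>m 1) (0\<^sub>m 1 n) (0\<^sub>m n 1) X :: real mat"
  have F: "?F a X \<in> carrier_mat ?n ?n" if "X \<in> carrier_mat n n" for a X
    using that four_block_carrier_mat[of "a \<cdot>\<^sub>m 1\<^sub>m 1" 1 1 X n n] by simp
  have FF: "?F a X * ?F b Y = ?F (a * b) (X * Y)" if "X \<in> carrier_mat n n" "Y \<in> carrier_mat n n" for a b X Y
    using that by (subst mult_four_block_mat[of _ 1 1 _ n _ n _ _ 1 _ n])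
      (auto intro!: arg_cong[of _ _ "\<lambda>Z. four_block_mat Z _ _ _"])
  have FT: "(?F a X)\<^sup>T = ?F a (X\<^sup>T)" if "X \<in> carrier_mat n n" for a X
    using that by (subst transpose_four_block_mat[of _ 1 1 _ n _ n]) (auto intro!: arg_cong[of _ _ "\<lambda>Z. four_block_mat Z _ _ _"])
  let ?P = "H * ?F 1 Q"
  have PT: "?P\<^sup>T = ?F 1 (Q\<^sup>T) * H\<^sup>T"
    unfolding FT[OF Q(1), symmetric] by (rule transpose_mult[OF H(1) F[OF Q(1)]])
  note assoc = assoc_mult_mat[of _ ?n ?n _ ?n _ ?n]
  have carr: "?F 1 (Q\<^sup>T) \<in> carrier_mat ?n ?n" "?F 1 Q \<in> carrier_mat ?n ?n" "H\<^sup>T \<in> carrier_mat ?n ?n"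
    using F Q H by auto
  have "?P\<^sup>T * ?P = ?F 1 (Q\<^sup>T) * ((H\<^sup>T * H) * ?F 1 Q)"
    using carr H(1) unfolding PT by (simp add: assoc)
  also have "\<dots> = ?F 1 (1\<^sub>m n)"
    using carr H(2) Q by (simp add: FF del: One_nat_def)
  also have "\<dots> = 1\<^sub>m ?n" by (intro eq_matI) auto
  finally have "?P\<^sup>T * ?P = 1\<^sub>m ?n" .
  moreover have "?P\<^sup>T * A * ?P = ?F e D"
  proof -
    have "?P\<^sup>T * A * ?P = ?F 1 (Q\<^sup>T) * ((H\<^sup>T * A * H) * ?F 1 Q)"
      using carr H(1) Suc.prems unfolding PT by (simp add: assoc)
    also have "\<dots> = ?F e (Q\<^sup>T * (B * Q))"
      unfolding HAH using B Q by (simp add: FF del: One_nat_def)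
    finally show ?thesis using B Q by (simp add: assoc_mult_mat[of _ n n _ n _ n])
  qed
  moreover have "diagonal_mat (?F e D)"
    using Q unfolding diagonal_mat_def by auto
  ultimately show ?case
    using mult_carrier_mat[OF H(1) carr(2)] F[OF Q(2)] by blast
qed

section \<open>Counting small eigenvalues\<close>

text \<open>Fewer than \<open>n\<close> homogeneous equations in \<open>n\<close> unknowns: stack
  \<open>fs\<close> as rows and pad with zero rows to a square matrix. Its last row is zero because
  \<open>length fs < n\<close>, so the determinant vanishes and the kernel is nontrivial.\<close>

lemma nonzero_vec_orthogonal_to_few:
  fixes fs :: "'a :: field vec list"
  assumes "set fs \<subseteq> carrier_vec n" and "length fs < n"
  shows "\<exists>x \<in> carrier_vec n. x \<noteq> 0\<^sub>v n \<and> (\<forall>f \<in> set fs. f \<bullet> x = 0)"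
proof -
  define M where "M = mat n n (\<lambda>(i, j). if i < length fs then (fs ! i) $ j else 0)"
  have M: "M \<in> carrier_mat n n" by (simp add: M_def)
  have "M\<^sup>T *\<^sub>v unit_vec n (n - 1) = 0\<^sub>v n"
    using assms(2) by (intro eq_vecI) (auto simp: M_def)
  moreover have "unit_vec n (n - 1) \<noteq> (0\<^sub>v n :: 'a vec)"
    using assms(2) by simp
  moreover have "M\<^sup>T \<in> carrier_mat n n" using M by simp
  ultimately have "det (M\<^sup>T) = 0"
    using det_0_iff_vec_prod_zero_field unit_vec_carrier by blast
  then have "det M = 0"
    using det_transpose[OF M] by simp
  then obtain x where x: "x \<in> carrier_vec n" "x \<noteq> 0\<^sub>v n" "M *\<^sub>v x = 0\<^sub>v n"
    using det_0_iff_vec_prod_zero_field[OF M] by blast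
  have "f \<bullet> x = 0" if "f \<in> set fs" for f
  proof -
    obtain i where i: "i < length fs" "f = fs ! i" using \<open>f \<in> set fs\<close> by (metis in_set_conv_nth)
    have f: "f \<in> carrier_vec n" using assms(1) that by auto
    have "row M i = f"
      using i f assms(2) by (intro eq_vecI) (auto simp: M_def)
    then have "(M *\<^sub>v x) $ i = f \<bullet> x" using M i assms(2) by simp
    then show ?thesis using x(3) i assms(2) by simp
  qed
  then show ?thesis using x by blast
qed

text \<open>If the entry at position \<open>k - 1\<close> exceeded \<open>c\<close>, sortedness
  would confine the entries that are at most \<open>c\<close> to positions below
  \<open>k - 1\<close>, leaving at most \<open>k - 1\<close> of them.\<close>

lemma sorted_nth_le_of_length_filter:
  fixes xs :: "'a :: linorder list"
  assumes "sorted xs" and "0 < k" and "k \<le> length (filter (\<lambda>x. x \<le> c) xs)"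
  shows "xs ! (k - 1) \<le> c"
proof (rule ccontr)
  assume "\<not> xs ! (k - 1) \<le> c"
  then have "{i. i < length xs \<and> xs ! i \<le> c} \<subseteq> {..<k - 1}"
    using assms(1) by (auto simp: not_le) (meson leD le_less_trans linorder_not_le sorted_nth_mono)
  then have "card {i. i < length xs \<and> xs ! i \<le> c} \<le> k - 1"
    by (metis card_lessThan card_mono finite_lessThan)
  then show False using assms by (simp add: length_filter_conv_card)
qed

text \<open>
  The upper bound of the Courant-Fischer principle: the \<open>n - length fs\<close>-dimensional space cut out by
  \<open>fs\<close> would meet the span of the eigenvectors with eigenvalue above \<open>c\<close> if those were more than
  \<open>n - k\<close>. Position \<open>n - k\<close> of the descending list holds the \<open>k\<close>-th smallest eigenvalue.
\<close>

lemma symmetric_mat_eigenvalue_le: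
  fixes A :: "real mat"
  assumes A: "A \<in> carrier_mat n n" and sym: "A\<^sup>T = A"
    and k: "0 < k" "k \<le> n"
    and fs: "set fs \<subseteq> carrier_vec n" "length fs \<le> n - k"
    and le: "\<And>x. x \<in> carrier_vec n \<Longrightarrow> \<forall>f \<in> set fs. f \<bullet> x = 0 \<Longrightarrow> x \<bullet> (A *\<^sub>v x) \<le> c * (x \<bullet> x)"
  shows "rev (sorted_list_of_multiset (proots (char_poly A))) ! (n - k) \<le> c"
proof -
  obtain P D where P: "P \<in> carrier_mat n n" and D: "D \<in> carrier_mat n n" "diagonal_mat D"
    and PP: "P\<^sup>T * P = 1\<^sub>m n" and PAP: "P\<^sup>T * A * P = D"
    using symmetric_mat_diagonalization[OF A sym] by blast
  have PP': "P * P\<^sup>T = 1\<^sub>m n"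
    using mat_mult_left_right_inverse[OF _ P PP] P by simp
  note assoc = assoc_mult_mat[of _ n n _ n _ n]
  have "P * D * P\<^sup>T = (P * P\<^sup>T) * A * (P * P\<^sup>T)"
    using P A by (simp add: PAP[symmetric] assoc)
  then have ADP: "A = P * D * P\<^sup>T"
    using A PP' by simp
  have "similar_mat A D"
    unfolding similar_mat_def similar_mat_wit_def Let_def
    using A P D PP PP' ADP by (intro exI[of _ P] exI[of _ "P\<^sup>T"]) auto
  then have "char_poly A = (\<Prod>a\<leftarrow>diag_mat D. [:- a, 1:])"
    using char_poly_similar char_poly_upper_triangular[OF D(1)] D
    by (metis (no_types, lifting) carrier_matD diagonal_mat_def order.strict_trans nat_neq_iff upper_triangularI)
  moreover have "proots (\<Prod>a\<leftarrow>xs. [:- a, 1:]) = mset xs" for xs :: "real list"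
  proof (induction xs)
    case (Cons a xs)
    \<comment> \<open>The root multiset is additive over a product only if the factors are
      nonzero.\<close>
    have "(\<Prod>a\<leftarrow>xs. [:- a, 1:]) \<noteq> 0" by (auto simp: prod_list_zero_iff)
    then show ?case by (simp add: proots_mult Cons.IH del: mult_pCons_left)
  qed simp
  ultimately have roots: "sorted_list_of_multiset (proots (char_poly A)) = sort (diag_mat D)"
    by simp
  \<comment> \<open>The columns of \<open>P\<close> are orthonormal eigenvectors; \<open>S\<close>
    indexes those with eigenvalue at most \<open>c\<close>, so \<open>card S\<close> counts these
    eigenvalues with multiplicity.\<close>
  define S where "S = {i. i < n \<and> D $$ (i, i) \<le> c}"
  have finS: "finite S" by (simp add: S_def)
  have "k \<le> card S"
  proof (rule ccontr)
    assume "\<not> k \<le> card S"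
    \<comment> \<open>These are fewer than \<open>(n - k) + k = n\<close> conditions, so some
      nonzero \<open>x\<close> satisfies \<open>fs\<close> and is orthogonal to all eigenvectors
      indexed by \<open>S\<close>.\<close>
    let ?gs = "fs @ map (col P) (sorted_list_of_set S)"
    have "set ?gs \<subseteq> carrier_vec n"
      using fs P finS by (auto simp: S_def)
    moreover have "length ?gs < n"
      using fs k \<open>\<not> k \<le> card S\<close> by simp
    ultimately obtain x where x: "x \<in> carrier_vec n" "x \<noteq> 0\<^sub>v n" "\<forall>g \<in> set ?gs. g \<bullet> x = 0"
      using nonzero_vec_orthogonal_to_few by blast
    \<comment> \<open>The coordinates of \<open>x\<close> in the eigenbasis; in them both
      \<open>x \<bullet> x\<close> and \<open>x \<bullet> A x\<close> become diagonal sums.\<close>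
    define y where "y = P\<^sup>T *\<^sub>v x"
    have y: "y \<in> carrier_vec n" using P x by (simp add: y_def)
    have x_eq: "x = P *\<^sub>v y"
      using P x PP' by (simp add: y_def assoc_mult_mat_vec[of _ n n _ n, symmetric])
    have Px: "x \<bullet> (P *\<^sub>v z) = y \<bullet> z" if "z \<in> carrier_vec n" for z
      using transpose_vec_mult_scalar[OF P that x(1)] P x that by (simp add: y_def)
    have "x \<bullet> x = y \<bullet> y" using Px[OF y] x_eq by simp
    then have xx: "x \<bullet> x = (\<Sum>i = 0..<n. y $ i * y $ i)"
      using y by (simp add: scalar_prod_def)
    have "A *\<^sub>v x = P *\<^sub>v (D *\<^sub>v y)"
      using P D x by (simp add: ADP y_def assoc_mult_mat_vec[of _ n n _ n])
    then have "x \<bullet> (A *\<^sub>v x) = y \<bullet> (D *\<^sub>v y)"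
      using Px D y by simp
    moreover have "(D *\<^sub>v y) $ i = D $$ (i, i) * y $ i" if "i < n" for i
    proof -
      have "(D *\<^sub>v y) $ i = (\<Sum>j = 0..<n. D $$ (i, j) * y $ j)"
        using that D y by (simp add: scalar_prod_def)
      also have "\<dots> = (\<Sum>j = 0..<n. if i = j then D $$ (i, j) * y $ j else 0)"
        using that D by (intro sum.cong) (auto simp: diagonal_mat_def)
      finally show ?thesis using that by simp
    qed
    ultimately have xAx: "x \<bullet> (A *\<^sub>v x) = (\<Sum>i = 0..<n. D $$ (i, i) * (y $ i * y $ i))"
      using D by (simp add: scalar_prod_def algebra_simps)
    have y0: "y $ i = 0" if "i \<in> S" for i
    proof -
      have "col P i \<bullet> x = 0" using x(3) finS that by auto
      then show ?thesis using that P x by (simp add: y_def S_def)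
    qed
    have "y \<noteq> 0\<^sub>v n"
      using x P by (auto simp: x_eq)
    then obtain i where i: "i < n" "y $ i \<noteq> 0"
      using y by (metis eq_vecI carrier_vecD index_zero_vec)
    \<comment> \<open>Coordinates in \<open>S\<close> vanish and all others have
      \<open>D $$ (i, i) > c\<close>; a nonzero coordinate makes the inequality strict, against the
      assumption on the quadratic form.\<close>
    have "(\<Sum>i = 0..<n. c * (y $ i * y $ i)) < (\<Sum>i = 0..<n. D $$ (i, i) * (y $ i * y $ i))"
    proof (rule sum_strict_mono_ex1)
      show "\<forall>i\<in>{0..<n}. c * (y $ i * y $ i) \<le> D $$ (i, i) * (y $ i * y $ i)"
      proof
        fix i assume "i \<in> {0..<n}"
        then show "c * (y $ i * y $ i) \<le> D $$ (i, i) * (y $ i * y $ i)"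
          using y0[of i] by (cases "i \<in> S") (auto simp: S_def intro!: mult_right_mono)
      qed
      have "i \<notin> S" using i y0 by blast
      then have "c < D $$ (i, i)" using i by (simp add: S_def)
      then have "c * (y $ i * y $ i) < D $$ (i, i) * (y $ i * y $ i)"
        using i by (intro mult_strict_right_mono) (auto simp: zero_less_mult_iff linorder_neq_iff)
      then show "\<exists>i\<in>{0..<n}. c * (y $ i * y $ i) < D $$ (i, i) * (y $ i * y $ i)"
        using i by auto
    qed simp
    then show False
      using le[OF x(1)] x(3) by (simp add: xx xAx sum_distrib_left)
  qed
  also have "card S = length (filter (\<lambda>d. d \<le> c) (diag_mat D))"
    using D by (auto simp: length_filter_conv_card S_def diag_mat_def intro!: arg_cong[of _ _ card])
  also have "\<dots> = length (filter (\<lambda>d. d \<le> c) (sort (diag_mat D)))"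
    by (metis filter_sort length_sort)
  finally have "sort (diag_mat D) ! (k - 1) \<le> c"
    using k by (intro sorted_nth_le_of_length_filter) auto
  moreover have "length (sort (diag_mat D)) = n"
    using D by (simp add: diag_mat_def)
  \<comment> \<open>Position \<open>n - k\<close> of the reversed list of length \<open>n\<close> is
    position \<open>k - 1\<close> in ascending order.\<close>
  ultimately show ?thesis
    using k by (simp add: roots rev_nth)
qed

section \<open>Eigenvalues of graphs with large cliques or independent sets\<close>

lemma vertex_enumeration:
  assumes "finite V"
  shows "distinct (vertex_enumeration V)" and "set (vertex_enumeration V) = V"
proof -
  have "\<exists>vs. distinct vs \<and> set vs = V" using finite_distinct_list[OF assms] by blast
  then have "distinct (vertex_enumeration V) \<and> set (vertex_enumeration V) = V"
    unfolding vertex_enumeration_def by (rule someI_ex)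
  then show "distinct (vertex_enumeration V)" and "set (vertex_enumeration V) = V" by auto
qed

lemma scalar_prod_mult_mat_vec:
  assumes "A \<in> carrier_mat n n" and "x \<in> carrier_vec n"
  shows "x \<bullet> (A *\<^sub>v x) = (\<Sum>i = 0..<n. \<Sum>j = 0..<n. x $ i * (A $$ (i, j) * x $ j))"
  using assms by (simp add: scalar_prod_def sum_distrib_left)

lemma adjacency_matrix_carrier [simp]:
  "adjacency_matrix vs E \<in> carrier_mat (length vs) (length vs)"
  by (simp add: adjacency_matrix_def)

lemma adjacency_matrix_transpose [simp]: "(adjacency_matrix vs E)\<^sup>T = adjacency_matrix vs E"
  by (intro eq_matI) (auto simp: adjacency_matrix_def insert_commute)

text \<open>The min-max bound for test vectors supported on \<open>R\<close>. Vanishing outside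
  \<open>R\<close> is expressed as orthogonality to \<open>card V - card R\<close> unit vectors;
  together with \<open>fs\<close> these must fit into the \<open>card V - k\<close> conditions
  allowed.\<close>

lemma graph_mu_le:
  assumes G: "finite_simple_graph V E" and R: "R \<subseteq> V" and k: "0 < k" "k \<le> card V"
    and fs: "set fs \<subseteq> carrier_vec (card V)" "length fs + (card V - card R) \<le> card V - k"
    and le: "\<And>x. x \<in> carrier_vec (card V) \<Longrightarrow>
      \<forall>i < card V. vertex_enumeration V ! i \<notin> R \<longrightarrow> x $ i = 0 \<Longrightarrow> \<forall>f \<in> set fs. f \<bullet> x = 0 \<Longrightarrow>
      x \<bullet> (adjacency_matrix (vertex_enumeration V) E *\<^sub>v x) \<le> c * (x \<bullet> x)"
  shows "graph_mu V E (card V - k + 1) \<le> c"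
proof -
  let ?vs = "vertex_enumeration V" and ?n = "card V"
  have fin: "finite V" using G by (simp add: finite_simple_graph_def)
  note vs = vertex_enumeration[OF fin]
  have len: "length ?vs = ?n" using vs by (metis distinct_card)
  define J where "J = {i. i < ?n \<and> ?vs ! i \<notin> R}"
  have finJ: "finite J" by (simp add: J_def)
  \<comment> \<open>The enumeration lists each vertex exactly once, so it maps \<open>J\<close>
    bijectively onto \<open>V - R\<close>.\<close>
  have "card J = card ((!) ?vs ` J)"
    using vs len by (intro card_image[symmetric]) (auto simp: inj_on_def J_def nth_eq_iff_index_eq)
  also have "(!) ?vs ` J = V - R"
  proof
    have "?vs ! i \<in> V" if "i < ?n" for i
      using that vs(2) len by (metis nth_mem)
    then show "(!) ?vs ` J \<subseteq> V - R"
      unfolding J_def by blast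
    show "V - R \<subseteq> (!) ?vs ` J"
    proof
      fix v assume "v \<in> V - R"
      moreover from this obtain i where "i < ?n" "?vs ! i = v"
        using vs(2) len by (metis DiffD1 in_set_conv_nth)
      ultimately show "v \<in> (!) ?vs ` J" by (auto simp: J_def)
    qed
  qed
  also have "card (V - R) = ?n - card R"
    using R fin by (simp add: card_Diff_subset finite_subset)
  finally have cardJ: "card J = ?n - card R" .
  let ?gs = "fs @ map (unit_vec ?n) (sorted_list_of_set J)"
  have "rev (sorted_list_of_multiset (proots (char_poly (adjacency_matrix ?vs E)))) ! (?n - k) \<le> c"
  proof (rule symmetric_mat_eigenvalue_le)
    show "adjacency_matrix ?vs E \<in> carrier_mat ?n ?n"
      using adjacency_matrix_carrier[of ?vs E] by (simp add: len)
    show "set ?gs \<subseteq> carrier_vec ?n" using fs by auto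
    show "length ?gs \<le> ?n - k" using fs cardJ by simp
    fix x :: "real vec" assume x: "x \<in> carrier_vec ?n" "\<forall>f \<in> set ?gs. f \<bullet> x = 0"
    have "x $ i = 0" if "i \<in> J" for i
    proof -
      have "unit_vec ?n i \<bullet> x = 0" using x(2) finJ that by auto
      then show ?thesis using that x(1) by (simp add: J_def)
    qed
    then show "x \<bullet> (adjacency_matrix ?vs E *\<^sub>v x) \<le> c * (x \<bullet> x)"
      using x by (intro le) (auto simp: J_def)
  qed (use k in auto)
  \<comment> \<open>The one-based index \<open>card V - k + 1\<close> is list position
    \<open>card V - k\<close>.\<close>
  then show ?thesis
    by (simp add: graph_mu_def graph_eigenvalues_def)
qed

text \<open>The adjacency matrix vanishes on pairs from \<open>R\<close>, so the quadratic form is 0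
  on vectors supported on \<open>R\<close>. No further condition is imposed, hence \<open>k\<close>
  may be as large as \<open>card R\<close>.\<close>

lemma graph_mu_le_of_indep:
  assumes G: "finite_simple_graph V E" and R: "R \<subseteq> V" "indep R E" and k: "0 < k" "k \<le> card R"
  shows "graph_mu V E (card V - k + 1) \<le> 0"
proof (rule graph_mu_le[where fs = "[]" and R = R])
  let ?vs = "vertex_enumeration V" and ?n = "card V"
  have fin: "finite V" using G by (simp add: finite_simple_graph_def)
  have len: "length ?vs = ?n" using vertex_enumeration[OF fin] by (metis distinct_card)
  have "card R \<le> ?n" using R fin by (simp add: card_mono)
  then show "k \<le> ?n" "length [] + (?n - card R) \<le> ?n - k" using k by auto
  fix x :: "real vec"
  assume x: "x \<in> carrier_vec ?n" "\<forall>i < ?n. ?vs ! i \<notin> R \<longrightarrow> x $ i = 0"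
  have "x $ i * (adjacency_matrix ?vs E $$ (i, j) * x $ j) = 0" if ij: "i < ?n" "j < ?n" for i j
  proof (cases "?vs ! i \<in> R \<and> ?vs ! j \<in> R")
    case True
    \<comment> \<open>Equal vertices give a singleton, which is no edge since edges have two
      elements; distinct vertices are covered by independence.\<close>
    then have "{?vs ! i, ?vs ! j} \<notin> E"
      using R(2) G by (cases "?vs ! i = ?vs ! j") (auto simp: indep_def finite_simple_graph_def nsets_def)
    then show ?thesis using ij len by (simp add: adjacency_matrix_def)
  qed (use x ij in auto)
  then have "(\<Sum>i = 0..<?n. \<Sum>j = 0..<?n. x $ i * (adjacency_matrix ?vs E $$ (i, j) * x $ j)) = 0"
    by (intro sum.neutral ballI) (simp only: atLeastLessThan_iff)
  then show "x \<bullet> (adjacency_matrix ?vs E *\<^sub>v x) \<le> 0 * (x \<bullet> x)"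
    using x(1) adjacency_matrix_carrier[of ?vs E]
    by (simp add: scalar_prod_mult_mat_vec[where n = ?n] len)
qed (use assms in auto)

text \<open>On \<open>R\<close> the adjacency matrix is the all-ones matrix minus the identity.
  Orthogonality to the all-ones vector removes the first term and costs one dimension, hence
  \<open>k < card R\<close>.\<close>

lemma graph_mu_le_of_clique:
  assumes G: "finite_simple_graph V E" and R: "R \<subseteq> V" "clique R E" and k: "0 < k" "k < card R"
  shows "graph_mu V E (card V - k + 1) \<le> -1"
proof (rule graph_mu_le[where fs = "[vec (card V) (\<lambda>_. 1)]" and R = R])
  let ?vs = "vertex_enumeration V" and ?n = "card V"
  have fin: "finite V" using G by (simp add: finite_simple_graph_def)
  note vs = vertex_enumeration[OF fin]
  have len: "length ?vs = ?n" using vs by (metis distinct_card)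
  have "card R \<le> ?n" using R fin by (simp add: card_mono)
  then show "k \<le> ?n" "length [vec ?n (\<lambda>_. 1)] + (?n - card R) \<le> ?n - k" using k by auto
  fix x :: "real vec"
  assume x: "x \<in> carrier_vec ?n" "\<forall>i < ?n. ?vs ! i \<notin> R \<longrightarrow> x $ i = 0"
    and "\<forall>f \<in> set [vec ?n (\<lambda>_. 1)]. f \<bullet> x = 0"
  then have sum0: "(\<Sum>j = 0..<?n. x $ j) = 0" by (simp add: scalar_prod_def)
  \<comment> \<open>Off \<open>R\<close> both sides are 0 because \<open>x $ i\<close> or
    \<open>x $ j\<close> is; on \<open>R\<close> only the diagonal term has to be removed.\<close>
  have entry: "x $ i * (adjacency_matrix ?vs E $$ (i, j) * x $ j)
      = x $ i * x $ j - (if i = j then x $ i * x $ j else 0)" if ij: "i < ?n" "j < ?n" for i j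
  proof (cases "?vs ! i \<in> R \<and> ?vs ! j \<in> R")
    case True
    then have "{?vs ! i, ?vs ! j} \<in> E \<longleftrightarrow> i \<noteq> j"
      using R(2) G ij vs len
      by (cases "i = j") (auto simp: clique_def finite_simple_graph_def nsets_def nth_eq_iff_index_eq)
    then show ?thesis using ij len by (simp add: adjacency_matrix_def)
  qed (use x ij in auto)
  have "x \<bullet> (adjacency_matrix ?vs E *\<^sub>v x)
      = (\<Sum>i = 0..<?n. \<Sum>j = 0..<?n. x $ i * (adjacency_matrix ?vs E $$ (i, j) * x $ j))"
    using x(1) adjacency_matrix_carrier[of ?vs E]
    by (intro scalar_prod_mult_mat_vec) (simp_all add: len)
  also have "\<dots> = (\<Sum>i = 0..<?n. x $ i * (\<Sum>j = 0..<?n. x $ j) - x $ i * x $ i)"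
    by (simp add: entry sum_subtractf sum_distrib_left)
  also have "\<dots> = - (x \<bullet> x)"
    using x(1) by (simp add: sum0 scalar_prod_def sum_negf)
  finally show "x \<bullet> (adjacency_matrix ?vs E *\<^sub>v x) \<le> -1 * (x \<bullet> x)" by simp
qed (use assms in auto)

theorem theorem12:
  fixes k n :: nat and V :: "'a set" and E :: "'a set set"
  assumes "k \<ge> 1" and "n \<ge> 4 ^ k"
    and "finite_simple_graph V E" and "card V = n"
  shows "(graph_mu V E (n - k + 1) \<le> -1 \<and> graph_mu V (complement_edges V E) (n - k + 1) \<le> 0) \<or>
         (graph_mu V (complement_edges V E) (n - k + 1) \<le> -1 \<and> graph_mu V E (n - k + 1) \<le> 0)"
proof -
  let ?E' = "complement_edges V E"
  have G': "finite_simple_graph V ?E'"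
    using assms(3) by (auto simp: finite_simple_graph_def complement_edges_def)
  \<comment> \<open>Ramsey with \<open>a = b = k\<close> gives \<open>Suc k\<close> vertices,
    exactly enough for the strict bound \<open>k < card R\<close> of the clique case.\<close>
  have "(2::nat) ^ (k + k) = 4 ^ k"
    by (simp flip: mult_2 add: power_mult)
  then obtain R where R: "R \<subseteq> V" "card R = Suc k" "clique R E \<or> indep R E"
    using clique_or_indep_of_two_power_le_card[of V k k E] assms
    by (auto simp: finite_simple_graph_def)
  from R(3) show ?thesis
  proof
    assume "clique R E"
    moreover from this have "indep R ?E'"
      by (auto simp: clique_def indep_def complement_edges_def)
    ultimately show ?thesis
      using graph_mu_le_of_clique[OF assms(3) R(1), of k] graph_mu_le_of_indep[OF G' R(1), of k]
        R(2) assms(1,4) by simp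
  next
    assume "indep R E"
    \<comment> \<open>Edges of the complement are pairs from \<open>V\<close>, so here
      \<open>R \<subseteq> V\<close> matters.\<close>
    moreover from this have "clique R ?E'"
      using R(1) by (auto simp: clique_def indep_def complement_edges_def)
    ultimately show ?thesis
      using graph_mu_le_of_clique[OF G' R(1), of k] graph_mu_le_of_indep[OF assms(3) R(1), of k]
        R(2) assms(1,4) by simp
  qed
qed

end
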